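(* Let $A,B^{(1)},B^{(2)},B^{(3)}\in\mathbb{R}^{2\times2}$ satisfy $A_{ij}=B^{(3)}_{ij}=0$ for $j>i$ and $B^{(1)}_{ij}=B^{(2)}_{ij}=0$ for $j\ge i$. Then the coefficients satisfy the strong order 0.5 conditions (listed in the context, with $s=2$) if and only if they belong to at least one of the following two classes. Class I: there are $A_{11},A_{21},B^{(3)}_{11}\in\mathbb{R}$ with $$A=\begin{pmatrix} A_{11} & 0 \\ A_{21} & 1-A_{21} \end{pmatrix},\quad B^{(1)}=\begin{pmatrix} 0 & 0 \\ 1 & 0 \end{pmatrix},\quad B^{(2)}=0,\quad B^{(3)}=\begin{pmatrix} B^{(3)}_{11} & 0 \\ 0 & 0 \end{pmatrix}.$$ Class II: there are $A_{11},A_{21},B^{(3)}_{21}\in\mathbb{R}$ with $$A=\begin{pmatrix} A_{11} & 0 \\ A_{21} & 1-A_{21} \end{pmatrix},\quad B^{(1)}=\begin{pmatrix} 0 & 0 \\ 1 & 0 \end{pmatrix},\quad B^{(2)}=0,\quad B^{(3)}=\begin{pmatrix} 0 & 0 \\ B^{(3)}_{21} & -B^{(3)}_{21} \end{pmatrix}.$$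
   Context: A stiffly accurate $s$-stage stochastic Runge-Kutta method is given by real $s\times s$ coefficient matrices $A,B^{(1)},B^{(2)},B^{(3)}$. Set $e=(1,\dots,1)^T\in\mathbb{R}^s$, let $\alpha=(A_{sj})_{j}$ be the last row of $A$ written as a column vector, and let $\beta^{(k)}=(B^{(k)}_{sj})_j$ be the last row of $B^{(k)}$ written as a column vector, $k=1,2,3$. The strong order 0.5 conditions are: $$\alpha^Te=1,\qquad {\beta^{(1)}}^Te=1,\qquad {\beta^{(2)}}^Te=0,\qquad {\beta^{(3)}}^Te=0,$$ $${\beta^{(1)}}^TB^{(1)}e+\tfrac12{\beta^{(2)}}^TB^{(2)}e+{\beta^{(3)}}^TB^{(3)}e=0.$$ *)

theory Defs
  imports "Jordan_Normal_Form.Matrix"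
begin

(* Matrix and vector indices start at 0, so the last row of an s x s matrix is row s - 1. *)

definition ones_vec :: "nat \<Rightarrow> real vec" where
  "ones_vec s = vec s (\<lambda>_. 1)"

definition strong_order_half ::
  "nat \<Rightarrow> real mat \<Rightarrow> real mat \<Rightarrow> real mat \<Rightarrow> real mat \<Rightarrow> bool" where
  "strong_order_half s A B1 B2 B3 \<longleftrightarrow>
    (let e = ones_vec s;
         \<alpha> = row A (s - 1);
         \<beta>1 = row B1 (s - 1);
         \<beta>2 = row B2 (s - 1);
         \<beta>3 = row B3 (s - 1)
     in \<alpha> \<bullet> e = 1 \<and> \<beta>1 \<bullet> e = 1 \<and> \<beta>2 \<bullet> e = 0 \<and> \<beta>3 \<bullet> e = 0 \<and>
        \<beta>1 \<bullet> (B1 *\<^sub>v e) + 1 / 2 * (\<beta>2 \<bullet> (B2 *\<^sub>v e)) + \<beta>3 \<bullet> (B3 *\<^sub>v e) = 0)"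

end

theory Submission
  imports Defs
begin

text \<open>The triangular shapes make the first and second quadratic terms vanish, and
  \<open>\<beta>\<^sup>(\<^sup>3\<^sup>)\<^sup>T e = 0\<close> reduces the third one to the product of the (2,1) and (1,1) entries of
  \<open>B\<^sup>(\<^sup>3\<^sup>)\<close>; the two classes correspond to the two factors of this product.\<close>

text \<open>Turns the matrix equations of both classes into scalar ones, so that the existential
  witnesses can be read off from the entries.\<close>

lemma mat_eq_mat_of_rows_list_2:
  assumes "M \<in> carrier_mat 2 2"
  shows "M = mat_of_rows_list 2 [[a, b], [c, d]] \<longleftrightarrow>
    M $$ (0, 0) = a \<and> M $$ (0, 1) = b \<and> M $$ (1, 0) = c \<and> M $$ (1, 1) = d"
  using assms by (auto simp: mat_eq_iff mat_of_rows_list_def numeral_2_eq_2 less_Suc_eq)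

lemma mat_eq_zero_2:
  assumes "M \<in> carrier_mat 2 2"
  shows "M = 0\<^sub>m 2 2 \<longleftrightarrow>
    M $$ (0, 0) = 0 \<and> M $$ (0, 1) = 0 \<and> M $$ (1, 0) = 0 \<and> M $$ (1, 1) = 0"
  using assms by (auto simp: mat_eq_iff numeral_2_eq_2 less_Suc_eq)

lemma row_ones_vec_2:
  assumes "M \<in> carrier_mat 2 2" and "i < 2"
  shows "row M i \<bullet> ones_vec 2 = M $$ (i, 0) + M $$ (i, 1)"
  using assms by (simp add: scalar_prod_def ones_vec_def numeral_2_eq_2)

text \<open>Meant for the quadratic terms with \<open>i = 1\<close>. The row sums stay factored, so
  a vanishing row sum removes a whole product.\<close>

lemma row_mult_ones_vec_2:
  assumes "M \<in> carrier_mat 2 2" and "i < 2"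
  shows "row M i \<bullet> (M *\<^sub>v ones_vec 2) =
    M $$ (i, 0) * (M $$ (0, 0) + M $$ (0, 1)) + M $$ (i, 1) * (M $$ (1, 0) + M $$ (1, 1))"
  using assms by (simp add: scalar_prod_def ones_vec_def numeral_2_eq_2)

theorem mainTheorem6:
  fixes A B1 B2 B3 :: "real mat"
  assumes "A \<in> carrier_mat 2 2" "B1 \<in> carrier_mat 2 2"
    "B2 \<in> carrier_mat 2 2" "B3 \<in> carrier_mat 2 2"
    and "\<forall>i<2. \<forall>j<2. j > i \<longrightarrow> A $$ (i, j) = 0 \<and> B3 $$ (i, j) = 0"
    and "\<forall>i<2. \<forall>j<2. j \<ge> i \<longrightarrow> B1 $$ (i, j) = 0 \<and> B2 $$ (i, j) = 0"
  shows "strong_order_half 2 A B1 B2 B3 \<longleftrightarrow>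
    (\<exists>a11 a21 b11 :: real.
        A = mat_of_rows_list 2 [[a11, 0], [a21, 1 - a21]] \<and>
        B1 = mat_of_rows_list 2 [[0, 0], [1, 0]] \<and>
        B2 = 0\<^sub>m 2 2 \<and>
        B3 = mat_of_rows_list 2 [[b11, 0], [0, 0]])
    \<or>
    (\<exists>a11 a21 b21 :: real.
        A = mat_of_rows_list 2 [[a11, 0], [a21, 1 - a21]] \<and>
        B1 = mat_of_rows_list 2 [[0, 0], [1, 0]] \<and>
        B2 = 0\<^sub>m 2 2 \<and>
        B3 = mat_of_rows_list 2 [[0, 0], [b21, - b21]])"
proof -
  have A: "A $$ (0, 1) = 0" and B3: "B3 $$ (0, 1) = 0"
    using assms(5) by auto
  have B12: "B1 $$ (0, 0) = 0" "B1 $$ (0, 1) = 0" "B1 $$ (1, 1) = 0"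
    "B2 $$ (0, 0) = 0" "B2 $$ (0, 1) = 0" "B2 $$ (1, 1) = 0"
    using assms(6) by auto
  \<comment> \<open>The last component of \<open>B3 *\<^sub>v ones_vec 2\<close> is the row sum that
    the fourth condition sets to 0.\<close>
  have order: "strong_order_half 2 A B1 B2 B3 \<longleftrightarrow>
      A $$ (1, 0) + A $$ (1, 1) = 1 \<and> B1 $$ (1, 0) = 1 \<and> B2 $$ (1, 0) = 0 \<and>
      B3 $$ (1, 0) + B3 $$ (1, 1) = 0 \<and> B3 $$ (1, 0) * B3 $$ (0, 0) = 0"
    using assms(1-4) B3 B12
    by (auto simp: strong_order_half_def Let_def row_ones_vec_2 row_mult_ones_vec_2)
  show ?thesis
    \<comment> \<open>If \<open>B3 $$ (1, 0) = 0\<close>, the zero row sum forces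
      \<open>B3 $$ (1, 1) = 0\<close>, which is Class I. If \<open>B3 $$ (0, 0) = 0\<close>, it
      gives the entry \<open>- b21\<close> of Class II.\<close>
    unfolding order
    using A B3 B12
    by (auto simp: assms(1-4) mat_eq_mat_of_rows_list_2 mat_eq_zero_2 algebra_simps)
qed

end
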